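(* The displacement field $S=\{\frac{dq}{dt},\frac{dp}{dt}\}$ of a dynamical system characterized by two variables $\{q,p\}$ is divergenceless if and only if the Jacobian determinant of the infinitesimal time evolution is equal to one.
   Context: The displacement field $S=\{S^q,S^p\}=\{\frac{dq}{dt},\frac{dp}{dt}\}$ gives the direction in which each state $(q,p)$ moves over time; it is divergenceless if $\frac{\partial S^q}{\partial q}+\frac{\partial S^p}{\partial p}=0$. The infinitesimal time evolution over a time $dt$ is the map $(q,p)\mapsto(Q,P)$ with $Q=q+S^q\,dt$ and $P=p+S^p\,dt$. Its Jacobian determinant is $|J|=\frac{\partial Q}{\partial q}\frac{\partial P}{\partial p}-\frac{\partial P}{\partial q}\frac{\partial Q}{\partial p}$, and, the evolution being infinitesimal, it is said to be equal to one when it is so to first order in $dt$, i.e. when the coefficient of $dt$ in $|J|=1+(\cdots)\,dt+O(dt^2)$ vanishes. The derivatives entering the divergence and the Jacobian are assumed to be well defined (when $S^q=\frac{\partial H}{\partial p}$ and $S^p=-\frac{\partial H}{\partial q}$ for a function $H$, this means that $H$ is assumed twice differentiable). *)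

theory Defs
  imports "HOL-Analysis.Analysis" "HOL-Library.Landau_Symbols"
begin

text \<open>A state is a pair (q, p). A displacement field maps a state to the pair (dq/dt, dp/dt).\<close>

definition partial_q :: "(real \<times> real \<Rightarrow> real) \<Rightarrow> real \<times> real \<Rightarrow> real" where
  "partial_q f x = deriv (\<lambda>u. f (u, snd x)) (fst x)"

definition partial_p :: "(real \<times> real \<Rightarrow> real) \<Rightarrow> real \<times> real \<Rightarrow> real" where
  "partial_p f x = deriv (\<lambda>v. f (fst x, v)) (snd x)"

text \<open>Since \<^const>\<open>deriv\<close> is total, existence of the partial derivatives is a separate
  predicate. Only the partial derivatives are required to exist, not the Frechet derivative.\<close>

definition has_partials_at :: "(real \<times> real \<Rightarrow> real) \<Rightarrow> real \<times> real \<Rightarrow> bool" where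
  "has_partials_at f x \<longleftrightarrow>
     (\<lambda>u. f (u, snd x)) field_differentiable (at (fst x)) \<and>
     (\<lambda>v. f (fst x, v)) field_differentiable (at (snd x))"

definition divergence :: "(real \<times> real \<Rightarrow> real \<times> real) \<Rightarrow> real \<times> real \<Rightarrow> real" where
  "divergence S x = partial_q (\<lambda>y. fst (S y)) x + partial_p (\<lambda>y. snd (S y)) x"

definition divergenceless_on ::
  "(real \<times> real) set \<Rightarrow> (real \<times> real \<Rightarrow> real \<times> real) \<Rightarrow> bool" where
  "divergenceless_on U S \<longleftrightarrow> (\<forall>x\<in>U. divergence S x = 0)"

definition infinitesimal_evolution ::
  "(real \<times> real \<Rightarrow> real \<times> real) \<Rightarrow> real \<Rightarrow> real \<times> real \<Rightarrow> real \<times> real" where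
  "infinitesimal_evolution S dt x = (fst x + fst (S x) * dt, snd x + snd (S x) * dt)"

definition jacobian_det :: "(real \<times> real \<Rightarrow> real \<times> real) \<Rightarrow> real \<times> real \<Rightarrow> real" where
  "jacobian_det F x =
     partial_q (\<lambda>y. fst (F y)) x * partial_p (\<lambda>y. snd (F y)) x -
     partial_q (\<lambda>y. snd (F y)) x * partial_p (\<lambda>y. fst (F y)) x"

definition has_first_order_coeff :: "(real \<Rightarrow> real) \<Rightarrow> real \<Rightarrow> bool" where
  "has_first_order_coeff f c \<longleftrightarrow> (\<lambda>dt. f dt - (1 + c * dt)) \<in> O[at 0](\<lambda>dt. dt\<^sup>2)"

text \<open>A function of dt equals one to first order if, in its expansion
  1 + c dt + O(dt^2) as dt tends to 0, the coefficient c is 0.\<close>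

definition equals_one_to_first_order :: "(real \<Rightarrow> real) \<Rightarrow> bool" where
  "equals_one_to_first_order f \<longleftrightarrow> has_first_order_coeff f 0"

end

theory Submission
  imports Defs
begin

text \<open>At a fixed state the Jacobian matrix of the evolution is I + dt * DS, with DS the matrix
  of partial derivatives of S. For a 2x2 matrix, det (I + dt * DS) = 1 + tr(DS) * dt + det(DS) *
  dt^2 exactly, and tr(DS) is the divergence (\<open>jacobian_det_infinitesimal_evolution\<close>).
  Such a quadratic in dt is 1 + O(dt^2) exactly when its linear coefficient vanishes
  (\<open>equals_one_to_first_order_quadratic_iff\<close>). The equivalence thus holds state by
  state, hence on all of \<open>U\<close>.\<close>

lemma deriv_add_mult_const:
  fixes f g :: "real \<Rightarrow> real"
  assumes "f field_differentiable at x" and "g field_differentiable at x"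
  shows "deriv (\<lambda>u. f u + g u * c) x = deriv f x + deriv g x * c"
  using assms
  by (intro DERIV_imp_deriv) (auto intro!: derivative_eq_intros simp: field_differentiable_derivI)

lemma jacobian_det_infinitesimal_evolution:
  assumes "has_partials_at (\<lambda>y. fst (S y)) x" and "has_partials_at (\<lambda>y. snd (S y)) x"
  shows "jacobian_det (infinitesimal_evolution S dt) x =
    1 + divergence S x * dt + jacobian_det S x * dt\<^sup>2"
proof -
  have "partial_q (\<lambda>y. fst (infinitesimal_evolution S dt y)) x = 1 + partial_q (\<lambda>y. fst (S y)) x * dt"
    "partial_p (\<lambda>y. fst (infinitesimal_evolution S dt y)) x = partial_p (\<lambda>y. fst (S y)) x * dt"
    "partial_q (\<lambda>y. snd (infinitesimal_evolution S dt y)) x = partial_q (\<lambda>y. snd (S y)) x * dt"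
    "partial_p (\<lambda>y. snd (infinitesimal_evolution S dt y)) x = 1 + partial_p (\<lambda>y. snd (S y)) x * dt"
    \<comment> \<open>In \<open>deriv_add_mult_const\<close>, \<open>f\<close> is the identity for
      the two diagonal entries and a constant for the two off-diagonal ones; this is where the
      entries 1 and 0 of I come from.\<close>
    using assms
    by (simp_all add: partial_q_def partial_p_def has_partials_at_def infinitesimal_evolution_def
        deriv_add_mult_const)
  then show ?thesis
    by (simp add: jacobian_det_def divergence_def algebra_simps power2_eq_square)
qed

text \<open>A nonzero linear term dominates t^2 near 0: a bound \<bar>a t\<bar> \<le> C t^2 can be
  divided by \<bar>t\<bar>, and letting t tend to 0 forces a = 0.\<close>

lemma linear_bigo_square_at_0_iff:
  fixes a :: real
  shows "(\<lambda>t. a * t) \<in> O[at 0](\<lambda>t. t\<^sup>2) \<longleftrightarrow> a = 0"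
proof
  assume "(\<lambda>t. a * t) \<in> O[at 0](\<lambda>t. t\<^sup>2)"
  then obtain C where "\<forall>\<^sub>F t in at 0. norm (a * t) \<le> C * norm (t\<^sup>2)"
    by (rule landau_o.bigE)
  moreover have "\<forall>\<^sub>F t in at 0. t \<noteq> (0::real)"
    \<comment> \<open>The filter \<open>at 0\<close> excludes the point 0 itself, which makes the
      cancellation of \<bar>t\<bar> below legitimate.\<close>
    by (simp add: eventually_at_filter)
  ultimately have "\<forall>\<^sub>F t in at 0. \<bar>a\<bar> \<le> C * \<bar>t\<bar>"
  proof eventually_elim
    case (elim t)
    then have "\<bar>a\<bar> * \<bar>t\<bar> \<le> (C * \<bar>t\<bar>) * \<bar>t\<bar>"
      by (simp only: real_norm_def abs_mult power2_eq_square mult.assoc)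
    with elim(2) show ?case
      by (simp add: mult_le_cancel_right)
  qed
  moreover have "((\<lambda>t. C * \<bar>t\<bar>) \<longlongrightarrow> 0) (at 0)"
    by (auto intro!: tendsto_eq_intros)
  ultimately have "\<bar>a\<bar> \<le> 0"
    by (intro tendsto_lowerbound) auto
  then show "a = 0"
    by simp
qed simp

lemma equals_one_to_first_order_quadratic_iff:
  "equals_one_to_first_order (\<lambda>t. 1 + a * t + b * t\<^sup>2) \<longleftrightarrow> a = 0"
proof -
  have b: "(\<lambda>t. b * t\<^sup>2) \<in> O[at 0](\<lambda>t. t\<^sup>2)"
    by simp
  have "(\<lambda>t. a * t + b * t\<^sup>2) \<in> O[at 0](\<lambda>t. t\<^sup>2) \<longleftrightarrow> (\<lambda>t. a * t) \<in> O[at 0](\<lambda>t. t\<^sup>2)"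
    \<comment> \<open>Adding the quadratic term gives one direction, subtracting it the
      other.\<close>
    using sum_in_bigo(1)[OF _ b, of "\<lambda>t. a * t"] sum_in_bigo(2)[OF _ b, of "\<lambda>t. a * t + b * t\<^sup>2"]
    by auto
  then show ?thesis
    unfolding linear_bigo_square_at_0_iff
    by (simp add: equals_one_to_first_order_def has_first_order_coeff_def)
qed

theorem proposition2:
  fixes U :: "(real \<times> real) set" and S :: "real \<times> real \<Rightarrow> real \<times> real"
  assumes "open U"
    and "\<And>x. x \<in> U \<Longrightarrow> has_partials_at (\<lambda>y. fst (S y)) x"
    and "\<And>x. x \<in> U \<Longrightarrow> has_partials_at (\<lambda>y. snd (S y)) x"
  shows "divergenceless_on U S \<longleftrightarrow>
    (\<forall>x\<in>U. equals_one_to_first_order (\<lambda>dt. jacobian_det (infinitesimal_evolution S dt) x))"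
  using assms(2,3)
  by (simp add: divergenceless_on_def jacobian_det_infinitesimal_evolution
      equals_one_to_first_order_quadratic_iff)

end
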